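(* Let $k\ge 1$ and $d\ge 0$ be integers. With Standard Eggs, the height $H_{\mathcal S,k}(d)$ of the tallest building for which the strength of the eggs can be determined starting with $k$ eggs and using no more than $d$ egg drops is $$H_{\mathcal S,k}(d)=\sum_{i=1}^{k}\binom{d}{i}.$$
   Context: Egg-drop problem: a building has floors $1,\dots,N$ (its height is $N$) and all eggs have the same unknown strength $s\in\{0,1,\dots,N\}$, every value being possible. An egg dropped from floor $x\in\{1,\dots,N\}$ survives if $x\le s$ and breaks if $x>s$. One starts with $k$ eggs; a drop can be made only if at least one egg is in hand; the floor of each drop may be chosen depending on the outcomes of the previous drops. Standard Eggs: each time an egg breaks the number of eggs in hand decreases by one, and each time an egg survives the number of eggs in hand is unchanged (no new eggs are received). $H_{\mathcal S,k}(d)$ is the largest $N$ for which there is a deterministic adaptive strategy, obeying these egg-supply rules, that determines $s$ using at most $d$ drops for every possible $s\in\{0,1,\dots,N\}$. *)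

theory Defs
  imports Main
begin

text \<open>A deterministic adaptive strategy is a finite decision tree: it either stops and reports a
  strength, or drops an egg from a floor and continues according to the outcome.  In
  \<open>Drop x u v\<close> the subtree \<open>u\<close> is followed if the egg survives, and \<open>v\<close> if it breaks.\<close>

datatype strategy = Report nat | Drop nat strategy strategy

definition survives :: "nat \<Rightarrow> nat \<Rightarrow> bool" where
  "survives s x \<longleftrightarrow> x \<le> s"

primrec reported :: "strategy \<Rightarrow> nat \<Rightarrow> nat" where
  "reported (Report r) s = r"
| "reported (Drop x u v) s = (if survives s x then reported u s else reported v s)"

primrec drops :: "strategy \<Rightarrow> nat \<Rightarrow> nat" where
  "drops (Report r) s = 0"
| "drops (Drop x u v) s = Suc (if survives s x then drops u s else drops v s)"

text \<open>\<open>standard_eggs N k t s\<close>: in a building of height \<open>N\<close>, starting with \<open>k\<close> eggs of strength \<open>s\<close>,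
  the run of \<open>t\<close> only uses existing floors, drops only when an egg is in hand, loses one egg per
  breakage and never receives eggs.  Only the branch actually followed for strength \<open>s\<close> is
  constrained.\<close>

primrec standard_eggs :: "nat \<Rightarrow> nat \<Rightarrow> strategy \<Rightarrow> nat \<Rightarrow> bool" where
  "standard_eggs N k (Report r) s \<longleftrightarrow> True"
| "standard_eggs N k (Drop x u v) s \<longleftrightarrow>
     x \<in> {1..N} \<and> k \<ge> 1 \<and>
     (if survives s x then standard_eggs N k u s else standard_eggs N (k - 1) v s)"

definition determinable :: "nat \<Rightarrow> nat \<Rightarrow> nat \<Rightarrow> bool" where
  "determinable k d N \<longleftrightarrow>
     (\<exists>t. \<forall>s\<in>{0..N}. standard_eggs N k t s \<and> drops t s \<le> d \<and> reported t s = s)"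

definition H_standard :: "nat \<Rightarrow> nat \<Rightarrow> nat" where
  "H_standard k d = (GREATEST N. determinable k d N)"

end

theory Submission
  imports Defs
begin

text \<open>A run with at most \<open>d\<close> drops and \<open>k\<close> eggs yields a sequence of at most \<open>d\<close> outcomes, of which
  at most \<open>k\<close> are breakages.  Strengths that a strategy tells apart reach different leaves, so
  their outcome sequences differ at some common position and stay different when padded to length
  \<open>d\<close> with survivals.  There are \<open>\<Sum>i\<le>k. d choose i\<close> ways to place at most \<open>k\<close> breakages among \<open>d\<close>
  drops, so at most that many strengths can be told apart; a building of height \<open>N\<close> has \<open>N + 1\<close>
  strengths, which removes the term \<open>i = 0\<close> from the sum.

  Both directions rest on the Pascal-type recurrence \<open>outcome_count_Suc_Suc\<close>, whose two summands
  count the outcomes after a survival and after a breakage.  For the upper bound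
  (\<open>card_identified_le\<close>), the first drop splits the identified strengths into two sets that the
  subtrees identify with the remaining resources.  For the lower bound (\<open>ex_strategy_interval\<close>),
  the first floor is chosen so that the two parts of the interval of candidates have
  exactly the sizes given by the two summands.\<close>

definition outcome_count :: "nat \<Rightarrow> nat \<Rightarrow> nat" where
  "outcome_count k d = (\<Sum>i\<le>k. d choose i)"

lemma outcome_count_0_left [simp]: "outcome_count 0 d = 1"
  by (simp add: outcome_count_def)

lemma outcome_count_0_right [simp]: "outcome_count k 0 = 1"
  by (induction k) (simp_all add: outcome_count_def)

lemma outcome_count_Suc_Suc:
  "outcome_count (Suc k) (Suc d) = outcome_count (Suc k) d + outcome_count k d"
  by (induction k) (simp_all add: outcome_count_def)

lemma outcome_count_eq_Suc: "outcome_count k d = Suc (\<Sum>i = 1..k. d choose i)"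
  by (induction k) (simp_all add: outcome_count_def)

lemma outcome_count_pos: "1 \<le> outcome_count k d"
  by (simp add: outcome_count_eq_Suc)

definition identifies :: "nat \<Rightarrow> nat \<Rightarrow> nat \<Rightarrow> strategy \<Rightarrow> nat \<Rightarrow> bool" where
  "identifies N k d t s \<longleftrightarrow> standard_eggs N k t s \<and> drops t s \<le> d \<and> reported t s = s"

lemma identifies_Report [simp]: "identifies N k d (Report r) s \<longleftrightarrow> r = s"
  by (simp add: identifies_def)

lemma identifies_Drop:
  "identifies N k d (Drop x u v) s \<longleftrightarrow>
     x \<in> {1..N} \<and> k \<ge> 1 \<and> d \<ge> 1 \<and>
     (if x \<le> s then identifies N k (d - 1) u s else identifies N (k - 1) (d - 1) v s)"
  by (cases d) (auto simp: identifies_def survives_def)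

text \<open>The set \<open>S\<close> is arbitrary rather than an interval: a tree may drop from redundant floors,
  and the induction only needs that the first floor cuts \<open>S\<close> into two disjoint parts.\<close>

lemma card_identified_le:
  assumes "finite S" and "\<forall>s\<in>S. identifies N k d t s"
  shows "card S \<le> outcome_count k d"
  using assms
proof (induction t arbitrary: S k d)
  case (Report r)
  then have "S \<subseteq> {r}"
    by auto
  then have "card S \<le> 1"
    using card_mono[of "{r}" S] by simp
  then show ?case
    using outcome_count_pos le_trans by blast
next
  case (Drop x u v)
  show ?case
  proof (cases "S = {}")
    case False
    then have "k \<ge> 1" "d \<ge> 1"
      using Drop.prems(2) by (auto simp: identifies_Drop)
    then obtain k' d' where kd: "k = Suc k'" "d = Suc d'"
      by (metis Suc_le_D One_nat_def)
    have survived: "card {s \<in> S. x \<le> s} \<le> outcome_count (Suc k') d'"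
      using Drop.prems by (intro Drop.IH(1)) (auto simp: identifies_Drop kd)
    have broken: "card {s \<in> S. \<not> x \<le> s} \<le> outcome_count k' d'"
      using Drop.prems by (intro Drop.IH(2)) (auto simp: identifies_Drop kd split: if_splits)
    have "S = {s \<in> S. x \<le> s} \<union> {s \<in> S. \<not> x \<le> s}"
      by auto
    then have "card S \<le> card {s \<in> S. x \<le> s} + card {s \<in> S. \<not> x \<le> s}"
      by (metis card_Un_le)
    with survived broken show ?thesis
      by (simp add: kd outcome_count_Suc_Suc)
  qed simp
qed

text \<open>After some drops, the candidates form an interval that may start anywhere in the building;
  hence the induction is over all starting points \<open>a\<close> while the height \<open>N\<close> stays fixed.\<close>

lemma ex_strategy_interval:
  assumes "a + outcome_count k d \<le> Suc N"
  shows "\<exists>t. \<forall>s\<in>{a..<a + outcome_count k d}. identifies N k d t s"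
  using assms
proof (induction d arbitrary: a k)
  case 0
  then show ?case
    by (intro exI[of _ "Report a"]) auto
next
  case (Suc d)
  show ?case
  proof (cases k)
    case 0
    then show ?thesis
      by (intro exI[of _ "Report a"]) auto
  next
    case k: (Suc k')
    \<comment> \<open>Just as many candidates lie below \<open>x\<close> as can be resolved after the egg has broken.\<close>
    define x where "x = a + outcome_count k' d"
    have total: "a + outcome_count k (Suc d) = x + outcome_count k d"
      by (simp add: k x_def outcome_count_Suc_Suc)
    with Suc.prems have bound: "x + outcome_count k d \<le> Suc N"
      by simp
    then obtain u where u: "\<forall>s\<in>{x..<x + outcome_count k d}. identifies N k d u s"
      using Suc.IH by blast
    have "a + outcome_count k' d \<le> Suc N"
      using bound by (simp add: x_def)
    then obtain v where v: "\<forall>s\<in>{a..<x}. identifies N k' d v s"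
      using Suc.IH unfolding x_def by blast
    have "x \<in> {1..N}"
      using bound outcome_count_pos[of k d] outcome_count_pos[of k' d] by (auto simp: x_def)
    then have "\<forall>s\<in>{a..<a + outcome_count k (Suc d)}. identifies N k (Suc d) (Drop x u v) s"
      using u v unfolding total by (auto simp: identifies_Drop k)
    then show ?thesis
      by blast
  qed
qed

lemma determinable_iff_identifies:
  "determinable k d N \<longleftrightarrow> (\<exists>t. \<forall>s\<in>{0..N}. identifies N k d t s)"
  by (simp add: determinable_def identifies_def)

theorem theorem3p1:
  fixes k d :: nat
  assumes "k \<ge> 1"
  shows "H_standard k d = (\<Sum>i = 1..k. d choose i)"
proof -
  let ?n = "\<Sum>i = 1..k. d choose i"
  have "determinable k d ?n"
    using ex_strategy_interval[of 0 k d ?n]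
    by (simp add: determinable_iff_identifies outcome_count_eq_Suc atLeastLessThanSuc_atLeastAtMost)
  moreover have "N \<le> ?n" if determinable: "determinable k d N" for N
  proof -
    obtain t where "\<forall>s\<in>{0..N}. identifies N k d t s"
      using determinable unfolding determinable_iff_identifies by blast
    then have "card {0..N} \<le> outcome_count k d"
      by (intro card_identified_le) auto
    then show ?thesis
      by (simp add: outcome_count_eq_Suc)
  qed
  ultimately show ?thesis
    unfolding H_standard_def by (intro Greatest_equality)
qed

end
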